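(* Let $\|\cdot\|_*$ be a norm on $\mathbb{R}^d$ that is differentiable at every $p\in\mathbb{R}^d\setminus\{0\}$, with dual norm $\|x\|=\sup\{\langle x,p\rangle:\|p\|_*=1\}$, let $\gamma\in(0,1)$, and let $$k(p)=\varphi_2^1(\|p\|_* )=\sqrt{\|p\|_*^2+1}-1.$$ Let $B\in[2,\infty)$, $A=B/(B-1)$. Let $f:\mathbb{R}^d\to\mathbb{R}$ be differentiable and convex with unique minimizer $x_\star$, and assume there exist $\mu,L\in(0,\infty)$ such that for all $x\in\mathbb{R}^d$ $$f(x)-f(x_\star)\ge\mu\,\varphi_2^B(\|x-x_\star\|),\qquad\varphi_2^1(\|\nabla f(x)\|_* )\le L\,(f(x)-f(x_\star)).$$ Then: 1. Conditions (A) and (B) of the context hold with $C_{\alpha,\gamma}=\gamma$, $C_{f,k}=\max\{1,L\}$ and the non-constant function $$\alpha(y)=\min\{\mu^{A-1},\mu,1\}\,(y+1)^{1-A}.$$ 2. If in addition $B>2$, $f$ is twice continuously differentiable on $\mathbb{R}^d\setminus\{x_\star\}$, and there exists $L_f\in(0,\infty)$ such that for all $x\in\mathbb{R}^d\setminus\{x_\star\}$ $$\psi\Big(\tfrac{B-1}{B-2}\,\varphi_1^{\frac{B-1}{B-2}}\Big(\frac{\lambda_{\max}^{\|\cdot\|}(\nabla^2f(x))}{L_f}\Big)\Big)\le3\,(f(x)-f(x_\star)),$$ where $\psi(t)=0$ for $0\le t<1$ and $\psi(t)=t-3t^{1/3}+2$ for $t\ge1$, then conditions (A), (B) and (C) hold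 with $C_{\alpha,\gamma}$, $C_{f,k}$, $\alpha$ as in part 1 and $$C_k=2,\qquad D_{f,k}=\frac{3L_f}{\min\{\mu^{A-1},\mu,1\}}.$$ 3. If in addition (to the assumptions preceding part 1) $B=2$, $f$ is twice continuously differentiable on $\mathbb{R}^d\setminus\{x_\star\}$, and there exists $L_f\in(0,\infty)$ such that $\lambda_{\max}^{\|\cdot\|}(\nabla^2f(x))\le L_f$ for all $x\in\mathbb{R}^d\setminus\{x_\star\}$, then conditions (A), (B) and (C) hold with $C_{\alpha,\gamma}$, $C_{f,k}$, $\alpha$ as in part 1 and $$C_k=2,\qquad D_{f,k}=\frac{6L_f}{\min\{\mu,1\}}.$$
   Context: For $a,A\in[1,\infty)$ and $t\in[0,\infty)$, $\varphi_a^A(t)=\frac1A(t^a+1)^{A/a}-\frac1A$. For a norm $\|\cdot\|$ on $\mathbb{R}^d$ and $M\in\mathbb{R}^{d\times d}$, $\lambda_{\max}^{\|\cdot\|}(M)=\sup\{\langle v,Mv\rangle:v\in\mathbb{R}^d,\|v\|=1\}$. Write $\mathcal{H}(x,p)=k(p)+f(x)-f(x_\star)$, $f_c(x)=f(x+x_\star)-f(x_\star)$, $f_c^*(p)=\sup\{\langle x,p\rangle-f_c(x):x\in\mathbb{R}^d\}$. The conditions are: (A) $f$ is differentiable and convex with unique minimizer $x_\star$; $k$ is differentiable and strictly convex with minimum $k(0)=0$; $\gamma\in(0,1)$; $\alpha:[0,\infty)\to(0,1]$ is differentiable, non-increasing and convex and $C_{\alpha,\gamma}\in(0,\gamma]$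 satisfy $k(p)\ge\alpha(k(p))\max(f_c^*(p),f_c^*(-p))$ for all $p\in\mathbb{R}^d$ and $-C_{\alpha,\gamma}\alpha'(y)y<\alpha(y)$ for all $y\ge0$. (B) $C_{f,k}\in(0,\infty)$ and $|\langle\nabla f(x),\nabla k(p)\rangle|\le C_{f,k}\mathcal{H}(x,p)$ for all $x,p\in\mathbb{R}^d$. (C) $f$ is convex with a unique minimizer $x_\star$ and is twice continuously differentiable on $\mathbb{R}^d\setminus\{x_\star\}$; $\langle\nabla k(p),p\rangle\le C_kk(p)$ for all $p\in\mathbb{R}^d$; and $\langle\nabla k(p),\nabla^2f(x)\nabla k(p)\rangle\le D_{f,k}\,\alpha(3\mathcal{H}(x,p))\,\mathcal{H}(x,p)$ for all $p\in\mathbb{R}^d$, $x\in\mathbb{R}^d\setminus\{x_\star\}$.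
   Formalization: Strict convexity of k in (A) fails if the unit sphere of ‖·‖_* contains a segment; the formal theorem concludes it only when ‖·‖_* is strictly convex (exactly when it holds), and otherwise convexity of k with all other clauses of (A). *)

theory Defs
  imports "HOL-Analysis.Analysis"
begin

definition is_norm :: "('a::real_vector \<Rightarrow> real) \<Rightarrow> bool" where
  "is_norm N \<longleftrightarrow> (\<forall>x. 0 \<le> N x) \<and> (\<forall>x. N x = 0 \<longleftrightarrow> x = 0) \<and>
     (\<forall>c x. N (c *\<^sub>R x) = \<bar>c\<bar> * N x) \<and> (\<forall>x y. N (x + y) \<le> N x + N y)"

definition dual_norm :: "(real^'n \<Rightarrow> real) \<Rightarrow> real^'n \<Rightarrow> real" where
  "dual_norm N x = Sup {x \<bullet> p | p. N p = 1}"

definition lambda_max :: "(real^'n \<Rightarrow> real) \<Rightarrow> real^'n^'n \<Rightarrow> real" where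
  "lambda_max N M = Sup {v \<bullet> (M *v v) | v. N v = 1}"

text \<open>For \<open>a, A \<ge> 1\<close> and \<open>t \<ge> 0\<close>; note that \<open>0 powr a = 0\<close> is the intended value.\<close>

definition phi :: "real \<Rightarrow> real \<Rightarrow> real \<Rightarrow> real" where
  "phi a A t = 1 / A * (t powr a + 1) powr (A / a) - 1 / A"

lemma phi_2_1: "0 \<le> t \<Longrightarrow> phi 2 1 t = sqrt (t\<^sup>2 + 1) - 1"
  by (simp add: phi_def powr_half_sqrt)

definition psi :: "real \<Rightarrow> real" where
  "psi t = (if t < 1 then 0 else t - 3 * t powr (1 / 3) + 2)"

definition grad :: "('a::real_inner \<Rightarrow> real) \<Rightarrow> 'a \<Rightarrow> 'a" where
  "grad f x = (THE D. GDERIV f x :> D)"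

definition hessian :: "(real^'n \<Rightarrow> real) \<Rightarrow> real^'n \<Rightarrow> real^'n^'n" where
  "hessian f x = matrix (frechet_derivative (grad f) (at x))"

text \<open>Meant for open \<open>S\<close>.\<close>

definition twice_cont_diff_on :: "(real^'n) set \<Rightarrow> (real^'n \<Rightarrow> real) \<Rightarrow> bool" where
  "twice_cont_diff_on S f \<longleftrightarrow>
     (\<forall>x\<in>S. f differentiable at x \<and> grad f differentiable at x) \<and> continuous_on S (hessian f)"

definition strictly_convex :: "('a::real_vector \<Rightarrow> real) \<Rightarrow> bool" where
  "strictly_convex g \<longleftrightarrow> (\<forall>x y u. x \<noteq> y \<longrightarrow> 0 < u \<longrightarrow> u < 1 \<longrightarrow>
     g ((1 - u) *\<^sub>R x + u *\<^sub>R y) < (1 - u) * g x + u * g y)"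

definition unique_minimizer :: "('a \<Rightarrow> real) \<Rightarrow> 'a \<Rightarrow> bool" where
  "unique_minimizer f xs \<longleftrightarrow> (\<forall>x. f xs \<le> f x) \<and> (\<forall>y. (\<forall>x. f y \<le> f x) \<longrightarrow> y = xs)"

definition hamiltonian ::
    "('a \<Rightarrow> real) \<Rightarrow> ('a \<Rightarrow> real) \<Rightarrow> 'a \<Rightarrow> 'a \<Rightarrow> 'a \<Rightarrow> real" where
  "hamiltonian f k xs x p = k p + f x - f xs"

definition centered :: "('a::plus \<Rightarrow> real) \<Rightarrow> 'a \<Rightarrow> 'a \<Rightarrow> real" where
  "centered f xs x = f (x + xs) - f xs"

text \<open>The supremum may a priori be infinite, hence the extended reals.\<close>

definition convex_conjugate :: "('a::real_inner \<Rightarrow> real) \<Rightarrow> 'a \<Rightarrow> ereal" where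
  "convex_conjugate g p = (SUP x. ereal (x \<bullet> p - g x))"

text \<open>Condition (A) is split into \<open>condition_A_base\<close>, everything except the strict
  convexity of \<open>k\<close>, and \<open>condition_A\<close>, which is the whole condition. At \<open>y = 0\<close> the derivative
  of \<open>\<alpha>\<close> on \<open>[0, \<infinity>)\<close> is one-sided.\<close>

definition condition_A_base ::
    "(real^'n \<Rightarrow> real) \<Rightarrow> (real^'n \<Rightarrow> real) \<Rightarrow> real^'n \<Rightarrow> real \<Rightarrow> (real \<Rightarrow> real) \<Rightarrow> real \<Rightarrow> bool" where
  "condition_A_base f k xs \<gamma> \<alpha> C \<longleftrightarrow>
     (\<forall>x. f differentiable at x) \<and> convex_on UNIV f \<and> unique_minimizer f xs \<and>
     (\<forall>p. k differentiable at p) \<and> (\<forall>p. 0 \<le> k p) \<and> k 0 = 0 \<and>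
     0 < \<gamma> \<and> \<gamma> < 1 \<and>
     (\<forall>y\<ge>0. 0 < \<alpha> y \<and> \<alpha> y \<le> 1) \<and> antimono_on {0..} \<alpha> \<and> convex_on {0..} \<alpha> \<and>
     0 < C \<and> C \<le> \<gamma> \<and>
     (\<forall>p. ereal (k p) \<ge> ereal (\<alpha> (k p)) *
        max (convex_conjugate (centered f xs) p) (convex_conjugate (centered f xs) (- p))) \<and>
     (\<exists>\<alpha>'. \<forall>y\<ge>0. (\<alpha> has_real_derivative \<alpha>' y) (at y within {0..}) \<and> - C * \<alpha>' y * y < \<alpha> y)"

definition condition_A ::
    "(real^'n \<Rightarrow> real) \<Rightarrow> (real^'n \<Rightarrow> real) \<Rightarrow> real^'n \<Rightarrow> real \<Rightarrow> (real \<Rightarrow> real) \<Rightarrow> real \<Rightarrow> bool" where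
  "condition_A f k xs \<gamma> \<alpha> C \<longleftrightarrow> condition_A_base f k xs \<gamma> \<alpha> C \<and> strictly_convex k"

definition condition_B ::
    "(real^'n \<Rightarrow> real) \<Rightarrow> (real^'n \<Rightarrow> real) \<Rightarrow> real^'n \<Rightarrow> real \<Rightarrow> bool" where
  "condition_B f k xs C \<longleftrightarrow>
     0 < C \<and> (\<forall>x p. \<bar>grad f x \<bullet> grad k p\<bar> \<le> C * hamiltonian f k xs x p)"

definition condition_C ::
    "(real^'n \<Rightarrow> real) \<Rightarrow> (real^'n \<Rightarrow> real) \<Rightarrow> real^'n \<Rightarrow> (real \<Rightarrow> real) \<Rightarrow> real \<Rightarrow> real \<Rightarrow> bool" where
  "condition_C f k xs \<alpha> C D \<longleftrightarrow>
     convex_on UNIV f \<and> unique_minimizer f xs \<and> twice_cont_diff_on (- {xs}) f \<and>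
     (\<forall>p. grad k p \<bullet> p \<le> C * k p) \<and>
     (\<forall>p. \<forall>x. x \<noteq> xs \<longrightarrow> grad k p \<bullet> (hessian f x *v grad k p)
        \<le> D * \<alpha> (3 * hamiltonian f k xs x p) * hamiltonian f k xs x p)"

text \<open>A norm that is differentiable away from \<open>0\<close> can have segments in its unit sphere, and
  \<open>p \<mapsto> sqrt ((N p)\<^sup>2 + 1) - 1\<close> is constant on such a segment, hence not strictly convex.
  In the plane, \<open>N (x, y) = \<bar>y\<bar>\<close> for \<open>\<bar>x\<bar> \<le> \<bar>y\<bar>\<close> and \<open>N (x, y) = (x\<^sup>2 + y\<^sup>2) / (2 * \<bar>x\<bar>)\<close>
  otherwise is an example; its unit ball is the union of a square and two half-discs. Strict
  convexity of that function is equivalent to the following property of the norm.\<close>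

definition rotund :: "('a::real_vector \<Rightarrow> real) \<Rightarrow> bool" where
  "rotund N \<longleftrightarrow> (\<forall>p q. N p = 1 \<longrightarrow> N q = 1 \<longrightarrow> p \<noteq> q \<longrightarrow> N (p + q) < 2)"

end

theory Submission
  imports Defs
begin

text \<open>
  Young's inequality applied to \<open>1 + t n \<le> sqrt (t\<^sup>2 + 1) sqrt (n\<^sup>2 + 1)\<close> gives
  \<open>t n \<le> phi 2 B t + phi 2 A n\<close>, which bounds the conjugate of \<open>f\<close> by \<open>phi 2 A (N p)\<close> up to the
  factor \<open>min (min (\<mu> powr (A - 1)) \<mu>) 1 = min \<mu> 1\<close>, whence (A). The dual norm of the gradient of
  \<open>k\<close> is at most \<open>n / sqrt (n\<^sup>2 + 1)\<close> with \<open>n = N p\<close>, whence (B). For (C) put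
  \<open>c = 1 - 1 / (k p + 1)\<^sup>2\<close>, a bound for the square of that dual norm,
  \<open>G y = y (y + 1) powr (1 - A)\<close> and, with \<open>l\<close> the normalised \<open>lambda_max\<close> and
  \<open>r = (B - 1) / (B - 2)\<close>, \<open>T = (l + 1) powr r - 1\<close>. Then \<open>l \<le> G T\<close>, and AM-GM together with the
  bound on \<open>psi T\<close> shows that \<open>c T\<close> is at most three times the Hamiltonian \<open>H\<close>, so that
  \<open>c l \<le> c G T \<le> G (c T) \<le> G (3 H)\<close>.
\<close>

section \<open>Convexity of \<open>sqrt (t^2 + 1)\<close>\<close>

text \<open>Lagrange's identity: the squares of the two sides differ by exactly
  \<open>(a - b)^2\<close>, so equality holds only for \<open>a = b\<close>.\<close>

lemma one_plus_mult_le_sqrt: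
  fixes a b :: real
  shows "1 + a * b \<le> sqrt (a\<^sup>2 + 1) * sqrt (b\<^sup>2 + 1)"
    and "a \<noteq> b \<Longrightarrow> 1 + a * b < sqrt (a\<^sup>2 + 1) * sqrt (b\<^sup>2 + 1)"
proof -
  have eq: "(a\<^sup>2 + 1) * (b\<^sup>2 + 1) = (1 + a * b)\<^sup>2 + (a - b)\<^sup>2"
    by (simp add: power2_eq_square algebra_simps)
  show "1 + a * b \<le> sqrt (a\<^sup>2 + 1) * sqrt (b\<^sup>2 + 1)"
    unfolding real_sqrt_mult[symmetric] eq by (rule real_le_rsqrt) simp
  show "1 + a * b < sqrt (a\<^sup>2 + 1) * sqrt (b\<^sup>2 + 1)" if "a \<noteq> b"
    unfolding real_sqrt_mult[symmetric] eq by (rule real_less_rsqrt) (use that in simp)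
qed

text \<open>After squaring, the two sides differ only in their cross terms, and these are compared
  by the strict Cauchy-Schwarz inequality above.\<close>

lemma sqrt_sq_plus_one_strict_convex:
  fixes a b u :: real
  assumes "a \<noteq> b" "0 < u" "u < 1"
  shows "sqrt (((1 - u) * a + u * b)\<^sup>2 + 1) < (1 - u) * sqrt (a\<^sup>2 + 1) + u * sqrt (b\<^sup>2 + 1)"
proof (rule real_less_lsqrt)
  have "2 * (u * (1 - u)) * (1 + a * b) < 2 * (u * (1 - u)) * (sqrt (a\<^sup>2 + 1) * sqrt (b\<^sup>2 + 1))"
    using one_plus_mult_le_sqrt(2)[OF assms(1)] assms(2,3) by (intro mult_strict_left_mono) auto
  moreover have "((1 - u) * a + u * b)\<^sup>2 + 1
      = (1 - u)\<^sup>2 * (a\<^sup>2 + 1) + u\<^sup>2 * (b\<^sup>2 + 1) + 2 * (u * (1 - u)) * (1 + a * b)"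
    by (simp add: power2_eq_square algebra_simps)
  moreover have "((1 - u) * sqrt (a\<^sup>2 + 1) + u * sqrt (b\<^sup>2 + 1))\<^sup>2
      = (1 - u)\<^sup>2 * (a\<^sup>2 + 1) + u\<^sup>2 * (b\<^sup>2 + 1)
        + 2 * (u * (1 - u)) * (sqrt (a\<^sup>2 + 1) * sqrt (b\<^sup>2 + 1))"
    by (simp add: power2_sum power_mult_distrib)
  ultimately show "((1 - u) * a + u * b)\<^sup>2 + 1 < ((1 - u) * sqrt (a\<^sup>2 + 1) + u * sqrt (b\<^sup>2 + 1))\<^sup>2"
    by linarith
qed (use assms in auto)

lemma sqrt_sq_plus_one_convex:
  fixes a b u :: real
  assumes "0 \<le> u" "u \<le> 1"
  shows "sqrt (((1 - u) * a + u * b)\<^sup>2 + 1) \<le> (1 - u) * sqrt (a\<^sup>2 + 1) + u * sqrt (b\<^sup>2 + 1)"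
proof (cases "a = b \<or> u = 0 \<or> u = 1")
  case True
  then show ?thesis by (auto simp: algebra_simps simp flip: distrib_right)
next
  case False
  then show ?thesis using sqrt_sq_plus_one_strict_convex[of a b u] assms by auto
qed

section \<open>Estimates for \<open>phi 2 B\<close> and \<open>phi 2 A\<close>\<close>

text \<open>With \<open>w = sqrt (t^2 + 1)\<close> this is \<open>(w powr B - 1) / B\<close>, a form
  to which Young's inequality applies directly.\<close>

lemma phi_2_eq: "0 \<le> t \<Longrightarrow> phi 2 B t = (sqrt (t\<^sup>2 + 1) powr B - 1) / B"
  by (simp add: phi_def powr_half_sqrt[symmetric] powr_powr diff_divide_distrib)

lemma phi_2_1_nonneg: "0 \<le> t \<Longrightarrow> 0 \<le> phi 2 1 t"
  by (simp add: phi_2_1)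

lemma phi_2_nonneg:
  assumes "0 < B" "0 \<le> t"
  shows "0 \<le> phi 2 B t"
  using assms by (simp add: phi_2_eq ge_one_powr_ge_zero)

text \<open>Cauchy--Schwarz for \<open>(t, 1)\<close> and \<open>(n, 1)\<close>, then Young's inequality.\<close>

lemma phi_2_Young:
  assumes "A > 1" "B > 1" "1 / A + 1 / B = 1" "0 \<le> t" "0 \<le> n"
  shows "t * n \<le> phi 2 B t + phi 2 A n"
proof -
  have "1 + t * n \<le> sqrt (t\<^sup>2 + 1) * sqrt (n\<^sup>2 + 1)"
    by (rule one_plus_mult_le_sqrt)
  also have "\<dots> \<le> sqrt (t\<^sup>2 + 1) powr B / B + sqrt (n\<^sup>2 + 1) powr A / A"
    using assms by (intro Youngs_inequality) auto
  finally show ?thesis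
    using assms by (simp add: phi_2_eq diff_divide_distrib)
qed

text \<open>Concavity of \<open>z \<mapsto> z powr (A / 2)\<close>.\<close>

lemma phi_2_rescale:
  assumes "1 \<le> A" "A \<le> 2" "0 < m" "m \<le> 1" "0 \<le> n"
  shows "m\<^sup>2 * phi 2 A (n / m) \<le> phi 2 A n"
proof -
  define a where "a = A / 2"
  define X where "X = n\<^sup>2 + 1"
  define Y where "Y = (n / m)\<^sup>2 + 1"
  have pos: "X > 0" "Y > 0" by (auto simp: X_def Y_def add_nonneg_pos)
  have a: "0 \<le> a" "a \<le> 1" using assms by (auto simp: a_def)
  have m1: "m\<^sup>2 \<le> 1" using assms by (simp add: power_le_one)
  \<comment> \<open>\<open>X\<close> is the convex combination of \<open>Y\<close> and 1 with weight
    \<open>m^2\<close>, so the claim is Jensen's inequality for \<open>z powr a\<close>. It is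
    obtained by averaging the tangent inequalities at \<open>X\<close>, each written as a weighted
    AM-GM and multiplied by \<open>X powr (1 - a)\<close>.\<close>
  have X: "X = m\<^sup>2 * Y + (1 - m\<^sup>2)" using assms by (simp add: X_def Y_def field_simps)
  have "Y powr a * X powr (1 - a) \<le> a * Y + (1 - a) * X"
    using a pos by (intro Youngs_inequality_0) auto
  then have 1: "m\<^sup>2 * (Y powr a * X powr (1 - a)) \<le> m\<^sup>2 * (a * Y + (1 - a) * X)"
    by (intro mult_left_mono) auto
  have "1 powr a * X powr (1 - a) \<le> a * 1 + (1 - a) * X"
    using a pos by (intro Youngs_inequality_0) auto
  then have 2: "(1 - m\<^sup>2) * (X powr (1 - a)) \<le> (1 - m\<^sup>2) * (a * 1 + (1 - a) * X)"
    using m1 by (intro mult_left_mono) auto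
  have "(m\<^sup>2 * Y powr a + (1 - m\<^sup>2)) * X powr (1 - a)
      \<le> m\<^sup>2 * (a * Y + (1 - a) * X) + (1 - m\<^sup>2) * (a * 1 + (1 - a) * X)"
    using add_mono[OF 1 2] by (simp add: algebra_simps)
  also have "\<dots> = a * (m\<^sup>2 * Y + (1 - m\<^sup>2)) + (1 - a) * X" by algebra
  also have "\<dots> = X" by (subst X[symmetric]) (simp add: algebra_simps)
  also have "X = X powr a * X powr (1 - a)" using pos by (simp flip: powr_add)
  finally have "m\<^sup>2 * Y powr a + (1 - m\<^sup>2) \<le> X powr a"
    using pos by (simp add: mult_le_cancel_right)
  then have "(m\<^sup>2 * Y powr a + (1 - m\<^sup>2) - 1) / A \<le> (X powr a - 1) / A"
    using assms by (intro divide_right_mono) auto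
  then show ?thesis
    using assms by (simp add: phi_def a_def X_def Y_def diff_divide_distrib algebra_simps)
qed

text \<open>If \<open>\<mu>\<close> is at least 1, the factor is 1 and the extra multiple of
  \<open>phi 2 B t\<close> only helps. Otherwise Young's inequality for \<open>t\<close> and
  \<open>n / \<mu>\<close> is multiplied by \<open>\<mu>^2\<close>, and \<open>phi_2_rescale\<close>
  absorbs this factor.\<close>

lemma phi_2_Young_scaled:
  assumes "1 < A" "A \<le> 2" "1 < B" "1 / A + 1 / B = 1" "0 < \<mu>" "0 \<le> t" "0 \<le> n"
  shows "min \<mu> 1 * (t * n - \<mu> * phi 2 B t) \<le> phi 2 A n"
proof (cases "\<mu> \<ge> 1")
  case True
  have "phi 2 B t \<le> \<mu> * phi 2 B t"
    using mult_right_mono[OF True phi_2_nonneg[of B t]] assms by simp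
  then show ?thesis using phi_2_Young[of A B t n] assms True by simp
next
  case False
  have "\<mu>\<^sup>2 * (t * (n / \<mu>)) \<le> \<mu>\<^sup>2 * (phi 2 B t + phi 2 A (n / \<mu>))"
    using assms by (intro mult_left_mono phi_2_Young) auto
  also have "\<dots> \<le> \<mu>\<^sup>2 * phi 2 B t + phi 2 A n"
    using phi_2_rescale[of A \<mu> n] assms False by (simp add: distrib_left)
  finally have "\<mu> * (t * n) \<le> \<mu>\<^sup>2 * phi 2 B t + phi 2 A n"
    using assms by (simp add: power2_eq_square)
  then show ?thesis using False by (simp add: power2_eq_square algebra_simps)
qed

text \<open>With \<open>w = phi 2 1 n + 1\<close> this is the tangent inequality for the convex
  function \<open>z powr A\<close> at \<open>w\<close>, evaluated at 1. The power on the right is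
  the reciprocal of the power in \<alpha>.\<close>

lemma phi_2_le_phi_2_1:
  assumes "1 < A" "0 \<le> n"
  shows "phi 2 A n \<le> phi 2 1 n * (phi 2 1 n + 1) powr (A - 1)"
proof -
  define w where "w = sqrt (n\<^sup>2 + 1)"
  have w: "w \<ge> 1" by (simp add: w_def)
  \<comment> \<open>Young's inequality for \<open>w powr (A - 1)\<close> and 1, with conjugate
    exponents \<open>A / (A - 1)\<close> and \<open>A\<close>.\<close>
  have "w powr (A - 1) * 1 \<le> (w powr (A - 1)) powr (A / (A - 1)) / (A / (A - 1)) + 1 powr A / A"
    using assms w by (intro Youngs_inequality) (auto simp: field_simps)
  moreover have "(w powr (A - 1)) powr (A / (A - 1)) = w powr A"
    using assms by (simp add: powr_powr)
  ultimately have "A * w powr (A - 1) \<le> (A - 1) * w powr A + 1"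
    using assms by (simp add: field_simps)
  moreover have "w powr A = w * w powr (A - 1)"
    using w by (simp add: powr_diff)
  ultimately have "w powr A - 1 \<le> A * ((w - 1) * w powr (A - 1))"
    by (simp add: algebra_simps)
  then have "(w powr A - 1) / A \<le> (w - 1) * w powr (A - 1)"
    using assms by (simp add: field_simps)
  moreover have "phi 2 1 n = w - 1" "phi 2 A n = (w powr A - 1) / A"
    using assms by (simp_all add: phi_2_1 phi_2_eq w_def)
  ultimately show ?thesis by simp
qed

section \<open>Scalar estimates for \<open>G\<close> and \<open>psi\<close>\<close>

text \<open>Monotonicity of \<open>G\<close>, where \<open>b = A - 1\<close>: it is the difference
  of a nondecreasing and a nonincreasing power of \<open>z + 1\<close>.\<close>

lemma mult_powr_minus_mono:
  fixes b x y :: real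
  assumes "0 \<le> b" "b \<le> 1" "0 \<le> x" "x \<le> y"
  shows "x * (x + 1) powr (- b) \<le> y * (y + 1) powr (- b)"
proof -
  have eq: "z * (z + 1) powr (- b) = (z + 1) powr (1 - b) - (z + 1) powr (- b)" if "0 \<le> z" for z
    using that by (simp add: powr_diff powr_minus field_simps)
  have "(x + 1) powr (1 - b) \<le> (y + 1) powr (1 - b)" "(y + 1) powr (- b) \<le> (x + 1) powr (- b)"
    using assms by (auto intro: powr_mono2 powr_mono2')
  then show ?thesis using assms by (simp add: eq)
qed

text \<open>Shrinking the argument can only enlarge the power with exponent \<open>- b\<close>, so a
  factor \<open>c\<close> in [0, 1] may be moved inside \<open>G\<close>.\<close>

lemma mult_powr_minus_scale:
  fixes b c x :: real
  assumes "0 \<le> b" "0 \<le> c" "c \<le> 1" "0 \<le> x"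
  shows "c * (x * (x + 1) powr (- b)) \<le> (c * x) * (c * x + 1) powr (- b)"
proof -
  have "c * x \<le> x" using assms by (simp add: mult_left_le_one_le)
  then have "(x + 1) powr (- b) \<le> (c * x + 1) powr (- b)"
    using assms by (intro powr_mono2') (auto simp: add_nonneg_pos)
  then show ?thesis unfolding mult.assoc using assms by (intro mult_left_mono)
qed

text \<open>This is what \<open>psi\<close> is made for: \<open>psi T\<close> is the maximum over
  \<open>w >= 1\<close> of \<open>(1 - 1 / w^2) * T - 2 * (w - 1)\<close>, attained at
  \<open>w = T powr (1 / 3)\<close> when \<open>T >= 1\<close>. Here
  \<open>w = s + 1\<close>.\<close>

lemma psi_bound:
  assumes "0 \<le> s" "0 \<le> T" "0 \<le> F" "psi T \<le> 3 * F"
  shows "(1 - 1 / (s + 1)\<^sup>2) * T \<le> 3 * (s + F)"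
proof (cases "T < 1")
  \<comment> \<open>Now \<open>psi T = 0\<close>, so the hypothesis gives no information; the first
    factor alone is at most \<open>3 * s\<close>.\<close>
  case True
  have "s\<^sup>2 + 2 * s = (s + 1)\<^sup>2 - 1" by (simp add: power2_eq_square algebra_simps)
  then have "1 - 1 / (s + 1)\<^sup>2 = (s\<^sup>2 + 2 * s) / (s + 1)\<^sup>2"
    using assms by (simp add: diff_divide_distrib)
  also have "\<dots> \<le> (3 * s * (s + 1)\<^sup>2) / (s + 1)\<^sup>2"
    using assms by (intro divide_right_mono) (auto simp: power2_eq_square algebra_simps)
  also have "\<dots> = 3 * s" using assms by simp
  finally have le: "1 - 1 / (s + 1)\<^sup>2 \<le> 3 * s" .
  have "(1 - 1 / (s + 1)\<^sup>2) * T \<le> (1 - 1 / (s + 1)\<^sup>2) * 1"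
    using assms True by (intro mult_left_mono) (auto simp: field_simps)
  then show ?thesis using le assms by simp
next
  case False
  define y where "y = T powr (1 / 3)"
  define w where "w = s + 1"
  have w: "w \<ge> 1" using assms by (simp add: w_def)
  have y: "y \<ge> 0" "T = y ^ 3"
    using False by (auto simp: y_def powr_powr simp flip: powr_realpow)
  \<comment> \<open>The factored gap in AM-GM for \<open>y^3\<close>, \<open>w^3\<close> and
    \<open>w^3\<close>.\<close>
  have "0 \<le> (y - w)\<^sup>2 * (y + 2 * w)" using w y by simp
  also have "\<dots> = y ^ 3 + 2 * w ^ 3 - 3 * y * w\<^sup>2"
    by (simp add: power2_eq_square power3_eq_cube algebra_simps)
  finally have "3 * y \<le> y ^ 3 / w\<^sup>2 + 2 * w"
    using w by (simp add: field_simps power2_eq_square power3_eq_cube)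
  moreover have "psi T = y ^ 3 - 3 * y + 2" unfolding psi_def y_def[symmetric] using False y by simp
  ultimately show ?thesis using assms by (simp add: w_def y(2) algebra_simps)
qed

section \<open>Equivalence of norms, dual norms and quadratic forms\<close>

lemma is_norm_zero: "is_norm N \<Longrightarrow> N 0 = 0"
  by (simp add: is_norm_def)

lemma is_norm_sum:
  assumes "is_norm N"
  shows "N (sum g S) \<le> (\<Sum>i\<in>S. N (g i))"
  using assms
proof (induction S rule: infinite_finite_induct)
  case (insert i S)
  then have "N (g i + sum g S) \<le> N (g i) + N (sum g S)" by (simp add: is_norm_def)
  then show ?case using insert by simp
qed (simp_all add: is_norm_zero)

text \<open>Expansion in the standard basis. The summand 1 in the constant makes its positivity
  immediate.\<close>

lemma is_norm_upper:
  fixes N :: "real^'n \<Rightarrow> real"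
  assumes "is_norm N"
  obtains C where "C > 0" "\<And>x. N x \<le> C * norm x"
proof
  define C where "C = (\<Sum>i\<in>UNIV. N (axis i 1)) + 1"
  have nonneg: "\<And>x. 0 \<le> N x" using assms by (simp add: is_norm_def)
  show "C > 0" by (auto simp: C_def nonneg intro!: add_nonneg_pos sum_nonneg)
  fix x
  have "N x = N (\<Sum>i\<in>UNIV. x $ i *\<^sub>R axis i 1)"
    by (metis basis_expansion scalar_mult_eq_scaleR)
  also have "\<dots> \<le> (\<Sum>i\<in>UNIV. N (x $ i *\<^sub>R axis i 1))" by (rule is_norm_sum[OF assms])
  also have "\<dots> = (\<Sum>i\<in>UNIV. \<bar>x $ i\<bar> * N (axis i 1))" using assms by (simp add: is_norm_def)
  also have "\<dots> \<le> (\<Sum>i\<in>UNIV. norm x * N (axis i 1))"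
    by (intro sum_mono mult_right_mono component_le_norm_cart nonneg)
  also have "\<dots> \<le> C * norm x" by (simp add: C_def sum_distrib_left algebra_simps)
  finally show "N x \<le> C * norm x" .
qed

text \<open>The reverse triangle inequality and the upper bound make \<open>N\<close> Lipschitz;
  continuity is what lets \<open>is_norm_lower\<close> use compactness.\<close>

lemma is_norm_continuous:
  fixes N :: "real^'n \<Rightarrow> real"
  assumes "is_norm N"
  shows "continuous_on S N"
proof -
  obtain C where C: "C > 0" "\<And>x. N x \<le> C * norm x" using is_norm_upper[OF assms] by metis
  have diff: "N x \<le> N y + N (x - y)" for x y
    using assms unfolding is_norm_def by (metis add.commute diff_add_cancel)
  have "dist (N x) (N y) \<le> C * dist x y" for x y
    using diff[of x y] diff[of y x] C(2)[of "x - y"] C(2)[of "y - x"]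
    by (simp add: dist_norm norm_minus_commute)
  then have "C-lipschitz_on S N" using C by (intro lipschitz_onI) auto
  then show ?thesis by (rule lipschitz_on_continuous_on)
qed

text \<open>\<open>N\<close> attains a positive minimum on the compact Euclidean unit sphere;
  homogeneity does the rest.\<close>

lemma is_norm_lower:
  fixes N :: "real^'n \<Rightarrow> real"
  assumes "is_norm N"
  obtains C where "C > 0" "\<And>x. norm x \<le> C * N x"
proof -
  have "\<exists>x\<in>sphere 0 1. \<forall>y\<in>sphere 0 1. N x \<le> N y"
    by (intro continuous_attains_inf is_norm_continuous assms) auto
  then obtain z where z: "norm z = 1" "\<And>y. norm y = 1 \<Longrightarrow> N z \<le> N y" by auto
  have Nz: "N z > 0" using assms z(1) unfolding is_norm_def by (metis less_eq_real_def norm_zero zero_neq_one)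
  have "norm x \<le> 1 / N z * N x" for x
  proof (cases "x = 0")
    case False
    have "N z \<le> N ((1 / norm x) *\<^sub>R x)" using False by (intro z(2)) simp
    also have "\<dots> = N x / norm x" using assms by (simp add: is_norm_def)
    finally show ?thesis using False Nz by (simp add: field_simps)
  qed (use assms in \<open>auto simp: is_norm_def\<close>)
  then show ?thesis using that[of "1 / N z"] Nz by simp
qed

lemma is_norm_unit_exists:
  fixes N :: "real^'n \<Rightarrow> real"
  assumes "is_norm N"
  shows "\<exists>p. N p = 1"
proof -
  \<comment> \<open>Index types are nonempty, so the dimension is at least one and some basis vector
    can be normalised.\<close>
  obtain i :: 'n where True by simp
  have "axis i (1::real) \<noteq> 0" by simp
  then have "N (axis i 1) \<noteq> 0" using assms by (simp add: is_norm_def)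
  then have "N ((1 / N (axis i 1)) *\<^sub>R axis i 1) = 1" using assms by (simp add: is_norm_def)
  then show ?thesis ..
qed

text \<open>A real \<open>Sup\<close> is meaningful only for nonempty sets bounded above. This lemma
  and \<open>is_norm_unit_exists\<close> make \<open>dual_norm\<close> a genuine supremum.\<close>

lemma dual_norm_bdd_above:
  fixes N :: "real^'n \<Rightarrow> real"
  assumes "is_norm N"
  shows "bdd_above {x \<bullet> p | p. N p = 1}"
proof -
  obtain C where C: "C > 0" "\<And>x. norm x \<le> C * N x" using is_norm_lower[OF assms] by metis
  have "x \<bullet> p \<le> norm x * C" if "N p = 1" for p
  proof -
    have "x \<bullet> p \<le> norm x * norm p" by (rule norm_cauchy_schwarz)
    also have "\<dots> \<le> norm x * C" using C(2)[of p] that by (intro mult_left_mono) auto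
    finally show ?thesis .
  qed
  then show ?thesis by (intro bdd_aboveI[of _ "norm x * C"]) auto
qed

lemma dual_norm_leI:
  fixes N :: "real^'n \<Rightarrow> real"
  assumes "is_norm N" "\<And>p. N p = 1 \<Longrightarrow> x \<bullet> p \<le> b"
  shows "dual_norm N x \<le> b"
  unfolding dual_norm_def using is_norm_unit_exists[OF assms(1)] assms(2)
  by (intro cSup_least) auto

lemma inner_le_dual_norm:
  fixes N :: "real^'n \<Rightarrow> real"
  assumes "is_norm N"
  shows "x \<bullet> p \<le> dual_norm N x * N p"
proof (cases "p = 0")
  case False
  then have Np: "N p > 0" using assms unfolding is_norm_def by (metis less_eq_real_def)
  then have "N ((1 / N p) *\<^sub>R p) = 1" using assms False by (simp add: is_norm_def)
  then have "x \<bullet> ((1 / N p) *\<^sub>R p) \<le> dual_norm N x"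
    unfolding dual_norm_def by (intro cSup_upper dual_norm_bdd_above assms) blast
  then show ?thesis using Np by (simp add: field_simps)
qed (simp add: is_norm_zero[OF assms])

lemma abs_inner_le_dual_norm:
  fixes N :: "real^'n \<Rightarrow> real"
  assumes "is_norm N"
  shows "\<bar>x \<bullet> p\<bar> \<le> dual_norm N x * N p"
proof -
  have "N (- p) = N p" using assms unfolding is_norm_def by (metis abs_1 abs_minus_cancel mult_1 scaleR_minus1_left)
  then show ?thesis using inner_le_dual_norm[OF assms, of x p] inner_le_dual_norm[OF assms, of x "- p"] by simp
qed

lemma dual_norm_nonneg:
  fixes N :: "real^'n \<Rightarrow> real"
  assumes "is_norm N"
  shows "0 \<le> dual_norm N x"
proof -
  obtain p where "N p = 1" using is_norm_unit_exists[OF assms] by blast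
  then show ?thesis using abs_inner_le_dual_norm[OF assms, of x p] by simp
qed

text \<open>Pairing \<open>x\<close> with itself gives
  \<open>norm x * norm x <= dual_norm N x * N x\<close>, and \<open>N x\<close> is at most a
  multiple of \<open>norm x\<close>.\<close>

lemma norm_le_dual_norm:
  fixes N :: "real^'n \<Rightarrow> real"
  assumes "is_norm N"
  obtains C where "C > 0" "\<And>x. norm x \<le> C * dual_norm N x"
proof -
  obtain C where C: "C > 0" "\<And>x. N x \<le> C * norm x" using is_norm_upper[OF assms] by metis
  have "norm x \<le> C * dual_norm N x" for x
  proof (cases "x = 0")
    case False
    have "norm x * norm x = x \<bullet> x" by (simp add: dot_square_norm power2_eq_square)
    also have "\<dots> \<le> dual_norm N x * N x" by (rule inner_le_dual_norm[OF assms])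
    also have "\<dots> \<le> dual_norm N x * (C * norm x)"
      by (intro mult_left_mono C dual_norm_nonneg assms)
    finally have "norm x * norm x \<le> (C * dual_norm N x) * norm x" by (simp add: mult_ac)
    then show ?thesis using False by (simp add: mult_le_cancel_right)
  qed (use C(1) dual_norm_nonneg[OF assms] in auto)
  then show ?thesis using that C(1) by blast
qed

lemma dual_norm_scaleR:
  fixes N :: "real^'n \<Rightarrow> real"
  assumes "is_norm N" "0 < c"
  shows "dual_norm N (c *\<^sub>R x) = c * dual_norm N x"
proof (rule antisym)
  have le: "dual_norm N (d *\<^sub>R y) \<le> d * dual_norm N y" if "0 < d" for d and y :: "real^'n"
  proof (rule dual_norm_leI[OF assms(1)])
    fix p assume "N p = 1"
    then show "(d *\<^sub>R y) \<bullet> p \<le> d * dual_norm N y"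
      using inner_le_dual_norm[OF assms(1), of y p] that by simp
  qed
  show "dual_norm N (c *\<^sub>R x) \<le> c * dual_norm N x" using le assms by simp
  \<comment> \<open>The reverse inequality is the same one for the factor \<open>1 / c\<close> and
    the vector \<open>c x\<close>.\<close>
  have "dual_norm N ((1 / c) *\<^sub>R c *\<^sub>R x) \<le> 1 / c * dual_norm N (c *\<^sub>R x)"
    using assms by (intro le) auto
  then show "c * dual_norm N x \<le> dual_norm N (c *\<^sub>R x)"
    using assms by (simp add: field_simps)
qed

text \<open>Both sides are homogeneous of degree two, so normalising \<open>v\<close> suffices. The
  operator norm and \<open>norm_le_dual_norm\<close> bound the quadratic form on the dual unit
  sphere, which makes the \<open>Sup\<close> genuine.\<close>

lemma inner_matrix_le_lambda_max:
  fixes N :: "real^'n \<Rightarrow> real" and M :: "real^'n^'n"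
  assumes "is_norm N"
  shows "v \<bullet> (M *v v) \<le> lambda_max (dual_norm N) M * (dual_norm N v)\<^sup>2"
proof (cases "v = 0")
  case True
  have "dual_norm N 0 \<le> 0" by (rule dual_norm_leI[OF assms]) simp
  then show ?thesis using True dual_norm_nonneg[OF assms, of 0] by simp
next
  case False
  obtain C where C: "C > 0" "\<And>x. norm x \<le> C * dual_norm N x"
    using norm_le_dual_norm[OF assms] by metis
  have lin: "bounded_linear ((*v) M)" by (rule matrix_vector_mul_bounded_linear)
  have "w \<bullet> (M *v w) \<le> C * (onorm ((*v) M) * C)" if "dual_norm N w = 1" for w
  proof -
    have w: "norm w \<le> C" using C(2)[of w] that by simp
    have "w \<bullet> (M *v w) \<le> norm w * norm (M *v w)" by (rule norm_cauchy_schwarz)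
    also have "\<dots> \<le> C * (onorm ((*v) M) * C)"
      using C(1) w order_trans[OF onorm[OF lin, of w] mult_left_mono[OF w onorm_pos_le[OF lin]]]
      by (intro mult_mono) auto
    finally show ?thesis .
  qed
  then have bdd: "bdd_above {w \<bullet> (M *v w) | w. dual_norm N w = 1}"
    by (intro bdd_aboveI[of _ "C * (onorm ((*v) M) * C)"]) auto
  have "0 < C * dual_norm N v" using C(2)[of v] False by (metis less_le_trans zero_less_norm_iff)
  then have pos: "0 < dual_norm N v" using C(1) by (simp add: zero_less_mult_iff)
  define w where "w = (1 / dual_norm N v) *\<^sub>R v"
  have "dual_norm N w = 1" unfolding w_def using pos by (subst dual_norm_scaleR[OF assms]) auto
  then have "w \<bullet> (M *v w) \<le> lambda_max (dual_norm N) M"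
    unfolding lambda_max_def by (intro cSup_upper bdd) blast
  then show ?thesis
    using pos by (simp add: w_def matrix_vector_mult_scaleR field_simps power2_eq_square)
qed

section \<open>The kinetic energy: differentiability, gradient bounds and convexity\<close>

text \<open>Justifies the \<open>THE\<close> in \<open>grad\<close>: the Riesz representative of the
  derivative \<open>f'\<close> is \<open>adjoint f' 1\<close>, and it is unique.\<close>

lemma GDERIV_grad:
  fixes f :: "real^'n \<Rightarrow> real"
  assumes "f differentiable at x"
  shows "GDERIV f x :> grad f x"
  unfolding grad_def
proof (rule theI')
  obtain f' where f': "(f has_derivative f') (at x)" using assms by (auto simp: differentiable_def)
  then interpret bounded_linear f' by (rule has_derivative_bounded_linear)
  have "f' = (\<lambda>h. h \<bullet> adjoint f' 1)"
    using adjoint_works[OF linear_axioms, of _ 1] by (simp add: fun_eq_iff)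
  then have "GDERIV f x :> adjoint f' 1" using f' unfolding gderiv_def by simp
  moreover have "D = D'" if "GDERIV f x :> D" "GDERIV f x :> D'" for D D'
  proof -
    have "(\<lambda>h. h \<bullet> D) = (\<lambda>h. h \<bullet> D')"
      using that unfolding gderiv_def by (rule has_derivative_unique)
    then show ?thesis by (metis vector_eq_ldot)
  qed
  ultimately show "\<exists>!D. GDERIV f x :> D" by blast
qed

text \<open>Away from 0 this is the chain rule. At 0, where \<open>N\<close> has a kink, the
  function is bounded by \<open>(N p)^2\<close>, hence by a multiple of \<open>(norm p)^2\<close>,
  so its derivative there is zero.\<close>

lemma phi_2_1_norm_differentiable:
  fixes N :: "real^'n \<Rightarrow> real"
  assumes N: "is_norm N" and diff: "\<And>p. p \<noteq> 0 \<Longrightarrow> N differentiable at p"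
  shows "(\<lambda>p. phi 2 1 (N p)) differentiable at p"
proof -
  have eq: "(\<lambda>p. phi 2 1 (N p)) = (\<lambda>p. sqrt ((N p)\<^sup>2 + 1) - 1)"
    using N by (simp add: phi_2_1 is_norm_def)
  show ?thesis
  proof (cases "p = 0")
    case False
    then obtain N' where N': "(N has_derivative N') (at p)" using diff by (auto simp: differentiable_def)
    have "(N p)\<^sup>2 + 1 > 0" by (simp add: add_nonneg_pos)
    then show ?thesis unfolding eq differentiable_def
      by (intro exI) (rule derivative_eq_intros N' refl | simp)+
  next
    case True
    obtain C where C: "C > 0" "\<And>x. N x \<le> C * norm x" using is_norm_upper[OF N] by metis
    have "((\<lambda>p. sqrt ((N p)\<^sup>2 + 1) - 1) has_derivative (\<lambda>_. 0)) (at 0)"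
    proof (rule has_derivativeI_sandwich[of 1 _ _ _ _ "\<lambda>p. C\<^sup>2 * norm p"])
      have "((\<lambda>p::real^'n. C\<^sup>2 * norm p) \<longlongrightarrow> C\<^sup>2 * norm (0::real^'n)) (at 0)"
        by (intro tendsto_intros)
      then show "((\<lambda>p::real^'n. C\<^sup>2 * norm p) \<longlongrightarrow> 0) (at 0)" by simp
      fix p :: "real^'n" assume "p \<noteq> 0"
      have "\<bar>sqrt ((N p)\<^sup>2 + 1) - 1\<bar> \<le> (N p)\<^sup>2"
        using real_le_lsqrt[of "(N p)\<^sup>2 + 1" "(N p)\<^sup>2 + 1"] self_le_power[of "(N p)\<^sup>2 + 1" 2] by simp
      also have "\<dots> \<le> (C * norm p)\<^sup>2" using N C by (intro power_mono) (auto simp: is_norm_def)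
      finally have "\<bar>sqrt ((N p)\<^sup>2 + 1) - 1\<bar> \<le> C\<^sup>2 * norm p * norm p"
        by (simp add: power2_eq_square mult_ac)
      moreover have "N 0 = 0" using N by (simp add: is_norm_def)
      ultimately show "norm (sqrt ((N p)\<^sup>2 + 1) - 1 - (sqrt ((N 0)\<^sup>2 + 1) - 1) - 0) / norm (p - 0) \<le> C\<^sup>2 * norm p"
        using \<open>p \<noteq> 0\<close> by (simp add: divide_le_eq)
    qed auto
    then show ?thesis unfolding eq True differentiable_def by blast
  qed
qed

text \<open>One-sided comparison along the ray \<open>p + t q\<close>, using \<open>N (p + t q) \<le> N p + t N q\<close>; the
  gradient of \<open>N\<close>, which does not exist at \<open>0\<close>, is thereby avoided.\<close>

lemma inner_grad_phi_2_1_norm_le: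
  fixes N :: "real^'n \<Rightarrow> real"
  assumes N: "is_norm N" and diff: "\<And>p. p \<noteq> 0 \<Longrightarrow> N differentiable at p"
  shows "grad (\<lambda>p. phi 2 1 (N p)) p \<bullet> q \<le> N p / sqrt ((N p)\<^sup>2 + 1) * N q"
proof (rule ccontr)
  define k where "k = (\<lambda>p. phi 2 1 (N p))"
  have keq: "k p = sqrt ((N p)\<^sup>2 + 1) - 1" for p
    using N by (simp add: k_def phi_2_1 is_norm_def)
  assume "\<not> ?thesis"
  then have pos: "0 < q \<bullet> grad k p - N p / sqrt ((N p)\<^sup>2 + 1) * N q"
    by (simp add: k_def inner_commute)
  have "(k has_derivative (\<lambda>h. h \<bullet> grad k p)) (at p)"
    using GDERIV_grad[OF phi_2_1_norm_differentiable[OF N diff]] by (simp add: gderiv_def k_def)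
  then have "(k has_derivative (\<lambda>h. h \<bullet> grad k p)) (at (p + 0 *\<^sub>R q))" by simp
  moreover have "((\<lambda>t. p + t *\<^sub>R q) has_derivative (\<lambda>t. t *\<^sub>R q)) (at 0)"
    by (auto intro!: derivative_eq_intros)
  ultimately have "((\<lambda>t. k (p + t *\<^sub>R q)) has_derivative (\<lambda>t. (t *\<^sub>R q) \<bullet> grad k p)) (at 0)"
    by (rule has_derivative_compose[rotated])
  then have "((\<lambda>t. k (p + t *\<^sub>R q)) has_real_derivative q \<bullet> grad k p) (at 0)"
    by (simp add: has_field_derivative_def mult_commute_abs)
  moreover have "(N p + 0 * N q)\<^sup>2 + 1 > 0" by (simp add: add_nonneg_pos)
  then have "((\<lambda>t. sqrt ((N p + t * N q)\<^sup>2 + 1) - 1) has_real_derivative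
      N p / sqrt ((N p)\<^sup>2 + 1) * N q) (at 0)"
    by (auto intro!: derivative_eq_intros simp: field_simps)
  ultimately have "((\<lambda>t. k (p + t *\<^sub>R q) - (sqrt ((N p + t * N q)\<^sup>2 + 1) - 1)) has_real_derivative
      q \<bullet> grad k p - N p / sqrt ((N p)\<^sup>2 + 1) * N q) (at 0)"
    by (rule DERIV_diff)
  \<comment> \<open>The difference vanishes at 0, so a positive slope would make it positive for
    small positive \<open>t\<close>; the triangle inequality forbids this.\<close>
  from DERIV_pos_inc_right[OF this pos] obtain d where d: "d > 0"
    "\<And>h. 0 < h \<Longrightarrow> h < d \<Longrightarrow> 0 < k (p + h *\<^sub>R q) - (sqrt ((N p + h * N q)\<^sup>2 + 1) - 1)"
    by (auto simp: keq)
  have "N (p + (d/2) *\<^sub>R q) \<le> N p + N ((d/2) *\<^sub>R q)" using N unfolding is_norm_def by blast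
  also have "\<dots> = N p + d/2 * N q" using N d(1) by (simp add: is_norm_def)
  finally have "(N (p + (d/2) *\<^sub>R q))\<^sup>2 \<le> (N p + d/2 * N q)\<^sup>2"
    using N by (intro power_mono) (auto simp: is_norm_def)
  then show False using d(2)[of "d/2"] d(1) by (simp add: keq)
qed

lemma dual_norm_grad_phi_2_1_norm_le:
  fixes N :: "real^'n \<Rightarrow> real"
  assumes "is_norm N" "\<And>p. p \<noteq> 0 \<Longrightarrow> N differentiable at p"
  shows "dual_norm N (grad (\<lambda>p. phi 2 1 (N p)) p) \<le> N p / sqrt ((N p)\<^sup>2 + 1)"
proof (rule dual_norm_leI[OF assms(1)])
  fix q assume "N q = 1"
  then show "grad (\<lambda>p. phi 2 1 (N p)) p \<bullet> q \<le> N p / sqrt ((N p)\<^sup>2 + 1)"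
    using inner_grad_phi_2_1_norm_le[OF assms, of p q] by simp
qed

lemma phi_2_1_norm_convex:
  fixes N :: "'a::real_vector \<Rightarrow> real"
  assumes "is_norm N"
  shows "convex_on UNIV (\<lambda>p. phi 2 1 (N p))"
proof (rule convex_onI)
  fix u :: real and x y :: 'a assume u: "0 < u" "u < 1"
  have "N ((1 - u) *\<^sub>R x + u *\<^sub>R y) \<le> N ((1 - u) *\<^sub>R x) + N (u *\<^sub>R y)"
    using assms unfolding is_norm_def by blast
  also have "\<dots> = (1 - u) * N x + u * N y" using assms u by (simp add: is_norm_def)
  finally have "sqrt ((N ((1 - u) *\<^sub>R x + u *\<^sub>R y))\<^sup>2 + 1) \<le> sqrt (((1 - u) * N x + u * N y)\<^sup>2 + 1)"
    using assms by (simp add: is_norm_def power_mono)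
  also have "\<dots> \<le> (1 - u) * sqrt ((N x)\<^sup>2 + 1) + u * sqrt ((N y)\<^sup>2 + 1)"
    using u by (intro sqrt_sq_plus_one_convex) auto
  finally show "phi 2 1 (N ((1 - u) *\<^sub>R x + u *\<^sub>R y)) \<le> (1 - u) * phi 2 1 (N x) + u * phi 2 1 (N y)"
    using assms by (simp add: phi_2_1 is_norm_def algebra_simps)
qed simp

text \<open>\<open>rotund\<close> speaks only of midpoints of unit vectors. Scaling by
  \<open>1 / r\<close> reaches the sphere of radius \<open>r\<close>, and any inner point of the
  segment is a convex combination of the midpoint and the nearer endpoint.\<close>

lemma rotund_segment_less:
  fixes N :: "'a::real_vector \<Rightarrow> real"
  assumes N: "is_norm N" and "rotund N" and "N x = r" "N y = r" "x \<noteq> y" "0 < u" "u < 1"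
  shows "N ((1 - u) *\<^sub>R x + u *\<^sub>R y) < r"
proof -
  have scale: "N (c *\<^sub>R z) = c * N z" if "0 \<le> c" for c z using N that by (simp add: is_norm_def)
  have tri: "N (a + b) \<le> N a + N b" for a b using N by (simp add: is_norm_def)
  have "r \<noteq> 0" using assms unfolding is_norm_def by auto
  then have r: "r > 0" using assms unfolding is_norm_def by (metis less_eq_real_def)
  have "N ((1 / r) *\<^sub>R x) = 1" "N ((1 / r) *\<^sub>R y) = 1" "(1 / r) *\<^sub>R x \<noteq> (1 / r) *\<^sub>R y"
    using assms r by (auto simp: scale)
  then have "N ((1 / r) *\<^sub>R x + (1 / r) *\<^sub>R y) < 2" using \<open>rotund N\<close> unfolding rotund_def by blast
  then have "N ((1 / r) *\<^sub>R (x + y)) < 2" by (simp only: scaleR_right_distrib)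
  moreover have "N ((1 / r) *\<^sub>R (x + y)) = N (x + y) / r" using r by (subst scale) auto
  ultimately have mid: "N (x + y) < 2 * r" using r by (simp only: divide_less_eq if_True)
  have double: "(2 * u) *\<^sub>R z = u *\<^sub>R z + u *\<^sub>R z" for z :: 'a
    by (metis mult_2 scaleR_left_distrib)
  show ?thesis
  proof (cases "u \<le> 1 / 2")
    case True
    have "(1 - u) *\<^sub>R x + u *\<^sub>R y = (1 - 2 * u) *\<^sub>R x + u *\<^sub>R (x + y)"
      by (simp add: double scaleR_left_diff_distrib scaleR_right_distrib)
    then have "N ((1 - u) *\<^sub>R x + u *\<^sub>R y) \<le> (1 - 2 * u) * r + u * N (x + y)"
      using tri[of "(1 - 2 * u) *\<^sub>R x" "u *\<^sub>R (x + y)"] True assms by (simp add: scale)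
    also have "\<dots> < (1 - 2 * u) * r + u * (2 * r)" using mid assms by simp
    finally show ?thesis by (simp add: algebra_simps)
  next
    case False
    have "(1 - u) *\<^sub>R x + u *\<^sub>R y = (2 * u - 1) *\<^sub>R y + (1 - u) *\<^sub>R (x + y)"
      by (simp add: double scaleR_left_diff_distrib scaleR_right_distrib)
    then have "N ((1 - u) *\<^sub>R x + u *\<^sub>R y) \<le> (2 * u - 1) * r + (1 - u) * N (x + y)"
      using tri[of "(2 * u - 1) *\<^sub>R y" "(1 - u) *\<^sub>R (x + y)"] False assms by (simp add: scale)
    also have "\<dots> < (2 * u - 1) * r + (1 - u) * (2 * r)" using mid assms by simp
    finally show ?thesis by (simp add: algebra_simps)
  qed
qed

text \<open>Strictness has two sources: rotundity when \<open>N x = N y\<close>, and the strict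
  convexity of \<open>sqrt (t^2 + 1)\<close> when the norms differ.\<close>

lemma phi_2_1_norm_strictly_convex:
  fixes N :: "'a::real_vector \<Rightarrow> real"
  assumes N: "is_norm N" and "rotund N"
  shows "strictly_convex (\<lambda>p. phi 2 1 (N p))"
  unfolding strictly_convex_def
proof (intro allI impI)
  fix x y :: 'a and u :: real assume xy: "x \<noteq> y" and u: "0 < u" "u < 1"
  let ?z = "(1 - u) *\<^sub>R x + u *\<^sub>R y"
  have nonneg: "0 \<le> N z" for z using N by (simp add: is_norm_def)
  have "sqrt ((N ?z)\<^sup>2 + 1) < (1 - u) * sqrt ((N x)\<^sup>2 + 1) + u * sqrt ((N y)\<^sup>2 + 1)"
  proof (cases "N x = N y")
    case True
    then have "N ?z < N y" using rotund_segment_less[OF assms _ _ xy u] by simp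
    then have "sqrt ((N ?z)\<^sup>2 + 1) < sqrt ((N y)\<^sup>2 + 1)" using nonneg by (simp add: power_strict_mono)
    then show ?thesis using True by (simp add: algebra_simps)
  next
    case False
    have "N ?z \<le> N ((1 - u) *\<^sub>R x) + N (u *\<^sub>R y)"
      using N unfolding is_norm_def by blast
    also have "\<dots> = (1 - u) * N x + u * N y" using N u by (simp add: is_norm_def)
    finally have "sqrt ((N ?z)\<^sup>2 + 1) \<le> sqrt (((1 - u) * N x + u * N y)\<^sup>2 + 1)"
      using nonneg by (simp add: power_mono)
    also have "\<dots> < (1 - u) * sqrt ((N x)\<^sup>2 + 1) + u * sqrt ((N y)\<^sup>2 + 1)"
      using False u by (rule sqrt_sq_plus_one_strict_convex)
    finally show ?thesis .
  qed
  then show "phi 2 1 (N ?z) < (1 - u) * phi 2 1 (N x) + u * phi 2 1 (N y)"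
    by (simp add: phi_2_1 nonneg algebra_simps)
qed

text \<open>Source of the constant 2 in (C): \<open>(w^2 - 1) / w <= 2 * (w - 1)\<close> amounts to
  \<open>(w - 1)^2 >= 0\<close>.\<close>

lemma inner_grad_phi_2_1_norm_self_le:
  fixes N :: "real^'n \<Rightarrow> real"
  assumes "is_norm N" "\<And>p. p \<noteq> 0 \<Longrightarrow> N differentiable at p"
  shows "grad (\<lambda>p. phi 2 1 (N p)) p \<bullet> p \<le> 2 * phi 2 1 (N p)"
proof -
  define w where "w = sqrt ((N p)\<^sup>2 + 1)"
  have w: "w \<ge> 1" "(N p)\<^sup>2 = w\<^sup>2 - 1" by (auto simp: w_def)
  have "grad (\<lambda>p. phi 2 1 (N p)) p \<bullet> p \<le> N p / w * N p"
    unfolding w_def by (rule inner_grad_phi_2_1_norm_le[OF assms])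
  also have "\<dots> = (w\<^sup>2 - 1) / w" using w(2) by (simp add: power2_eq_square)
  also have "\<dots> \<le> 2 * (w - 1)"
  proof -
    have "w\<^sup>2 - 1 \<le> 2 * (w - 1) * w"
      using zero_le_power2[of "w - 1"] by (simp add: power2_eq_square algebra_simps)
    then show ?thesis using w(1) by (subst pos_divide_le_eq) auto
  qed
  also have "w - 1 = phi 2 1 (N p)" using assms(1) by (simp add: w_def phi_2_1 is_norm_def)
  finally show ?thesis .
qed

text \<open>Since \<open>(N p)^2 + 1\<close> is the square of \<open>phi 2 1 (N p) + 1\<close>, the
  gradient bound depends on the kinetic energy alone; the right side is \<open>c\<close>.\<close>

lemma dual_norm_grad_sq_le:
  fixes N :: "real^'n \<Rightarrow> real"
  assumes "is_norm N" "\<And>p. p \<noteq> 0 \<Longrightarrow> N differentiable at p"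
  shows "(dual_norm N (grad (\<lambda>p. phi 2 1 (N p)) p))\<^sup>2 \<le> 1 - 1 / (phi 2 1 (N p) + 1)\<^sup>2"
proof -
  have nz: "(N p)\<^sup>2 + 1 \<noteq> 0" using zero_le_power2[of "N p"] by linarith
  have "(dual_norm N (grad (\<lambda>p. phi 2 1 (N p)) p))\<^sup>2 \<le> (N p / sqrt ((N p)\<^sup>2 + 1))\<^sup>2"
    by (intro power_mono dual_norm_grad_phi_2_1_norm_le dual_norm_nonneg assms)
  also have "\<dots> = ((N p)\<^sup>2 + 1 - 1) / ((N p)\<^sup>2 + 1)" by (simp add: power_divide)
  also have "\<dots> = 1 - 1 / ((N p)\<^sup>2 + 1)"
    by (subst diff_divide_distrib) (simp add: nz)
  also have "(N p)\<^sup>2 + 1 = (phi 2 1 (N p) + 1)\<^sup>2"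
    using assms(1) by (simp add: phi_2_1 is_norm_def)
  finally show ?thesis .
qed

section \<open>Conditions (A), (B) and (C) for the kinetic energy\<close>

lemma has_real_derivative_shifted_powr:
  fixes c e y :: real
  assumes "y > - 1"
  shows "((\<lambda>y. c * (y + 1) powr e) has_real_derivative c * e * (y + 1) powr (e - 1)) (at y)"
proof -
  have "((\<lambda>y. y + 1) has_real_derivative 1) (at y)" by (auto intro!: derivative_eq_intros)
  from DERIV_cmult[OF DERIV_fun_powr[OF this, of e], of c] assms show ?thesis
    by (simp add: mult.assoc)
qed

text \<open>The two factors of \<alpha> have separate origins: \<open>min \<mu> 1\<close> comes from
  \<open>phi_2_Young_scaled\<close>, and the power from \<open>phi_2_le_phi_2_1\<close>.\<close>

lemma condition_A_baseI:
  fixes f :: "real^'n \<Rightarrow> real" and N :: "real^'n \<Rightarrow> real"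
  assumes N: "is_norm N" and diff: "\<And>p. p \<noteq> 0 \<Longrightarrow> N differentiable at p"
    and gamma: "0 < \<gamma>" "\<gamma> < 1"
    and AB: "1 < A" "A \<le> 2" "1 < B" "1 / A + 1 / B = 1"
    and f: "\<And>x. f differentiable at x" "convex_on UNIV f" "unique_minimizer f xs"
    and mu: "0 < \<mu>"
    and lower: "\<And>x. f x - f xs \<ge> \<mu> * phi 2 B (dual_norm N (x - xs))"
  shows "condition_A_base f (\<lambda>p. phi 2 1 (N p)) xs \<gamma> (\<lambda>y. min \<mu> 1 * (y + 1) powr (1 - A)) \<gamma>"
proof -
  define k where "k = (\<lambda>p. phi 2 1 (N p))"
  define m where "m = min \<mu> 1"
  define \<alpha> where "\<alpha> = (\<lambda>y. m * (y + 1) powr (1 - A))"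
  have m: "0 < m" "m \<le> 1" using mu by (auto simp: m_def)
  have Nn: "0 \<le> N p" for p using N by (simp add: is_norm_def)
  have kn: "0 \<le> k p" for p using phi_2_1_nonneg[OF Nn] by (simp add: k_def)
  have \<alpha>_pos: "0 < \<alpha> y" if "0 \<le> y" for y using m that by (simp add: \<alpha>_def)
  have \<alpha>_le: "\<alpha> y \<le> 1" if "0 \<le> y" for y
  proof -
    have "(y + 1) powr (1 - A) \<le> (y + 1) powr 0" using that AB by (intro powr_mono) auto
    then show ?thesis using m mult_mono[of m 1 "(y + 1) powr (1 - A)" 1] that by (simp add: \<alpha>_def)
  qed
  have deriv: "(\<alpha> has_real_derivative m * (1 - A) * (y + 1) powr (1 - A - 1)) (at y)" if "0 \<le> y" for y
    unfolding \<alpha>_def using that by (intro has_real_derivative_shifted_powr) auto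
  have anti: "antimono_on {0..} \<alpha>"
    by (rule monotone_onI) (use m AB in \<open>auto simp: \<alpha>_def intro!: mult_left_mono powr_mono2'\<close>)
  have convex: "convex_on {0..} \<alpha>"
  proof (rule f''_ge0_imp_convex)
    fix y :: real assume y: "y \<in> {0..}"
    show "(\<alpha> has_real_derivative m * (1 - A) * (y + 1) powr (1 - A - 1)) (at y)"
      using y deriv by simp
    show "((\<lambda>y. m * (1 - A) * (y + 1) powr (1 - A - 1)) has_real_derivative
        m * (1 - A) * (1 - A - 1) * (y + 1) powr (1 - A - 1 - 1)) (at y)"
      using y by (intro has_real_derivative_shifted_powr) auto
    have "0 \<le> m * ((A - 1) * A)" using m AB by simp
    then have "0 \<le> m * (1 - A) * (1 - A - 1)" by (simp add: algebra_simps)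
    then show "0 \<le> m * (1 - A) * (1 - A - 1) * (y + 1) powr (1 - A - 1 - 1)"
      by (rule mult_nonneg_nonneg) simp
  qed simp
  have slope: "- \<gamma> * (m * (1 - A) * (y + 1) powr (1 - A - 1)) * y < \<alpha> y" if y: "0 \<le> y" for y
  proof -
    \<comment> \<open>After division by \<open>m * (y + 1) powr (- A)\<close> the claim reads
      \<open>\<gamma> * (A - 1) * y < y + 1\<close>.\<close>
    have "\<gamma> * (A - 1) \<le> 1 * 1" using gamma AB by (intro mult_mono) auto
    then have "\<gamma> * (A - 1) * y \<le> 1 * y" using y by (intro mult_right_mono) auto
    then have "(m * (y + 1) powr (- A)) * (\<gamma> * (A - 1) * y) < (m * (y + 1) powr (- A)) * (y + 1)"
      using m y by (intro mult_strict_left_mono) auto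
    moreover have "(y + 1) powr (1 - A) = (y + 1) powr (- A) * (y + 1)"
      using y by (simp add: powr_diff powr_minus field_simps)
    ultimately show ?thesis by (simp add: \<alpha>_def algebra_simps)
  qed
  \<comment> \<open>A real bound on every term of the supremum rules out the value infinity, so the
    product with \<open>\<alpha> (k p)\<close> can be treated as a real one.\<close>
  have conj_le: "convex_conjugate (centered f xs) p \<le> ereal (k p / \<alpha> (k p))" for p
    unfolding convex_conjugate_def
  proof (rule SUP_least)
    fix x :: "real^'n"
    define X where "X = x \<bullet> p - centered f xs x"
    have "X \<le> dual_norm N x * N p - \<mu> * phi 2 B (dual_norm N x)"
      using inner_le_dual_norm[OF N, of x p] lower[of "x + xs"] by (simp add: X_def centered_def)
    then have "m * X \<le> m * (dual_norm N x * N p - \<mu> * phi 2 B (dual_norm N x))"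
      using m by (intro mult_left_mono) auto
    also have "\<dots> \<le> phi 2 A (N p)"
      unfolding m_def using AB mu dual_norm_nonneg[OF N] Nn by (intro phi_2_Young_scaled) auto
    also have "\<dots> \<le> k p * (k p + 1) powr (A - 1)"
      unfolding k_def by (rule phi_2_le_phi_2_1[OF AB(1) Nn])
    \<comment> \<open>Multiplying by this power cancels the growth factor on the right and completes
      \<open>m\<close> to \<open>\<alpha> (k p)\<close> on the left.\<close>
    finally have "m * X * (k p + 1) powr (1 - A) \<le> k p * (k p + 1) powr (A - 1) * (k p + 1) powr (1 - A)"
      by (intro mult_right_mono) auto
    also have "\<dots> = k p * (k p + 1) powr (A - 1 + (1 - A))" by (simp only: powr_add mult.assoc)
    also have "\<dots> = k p" using kn[of p] by simp
    finally have "X * \<alpha> (k p) \<le> k p" by (simp add: \<alpha>_def mult_ac)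
    then show "ereal (x \<bullet> p - centered f xs x) \<le> ereal (k p / \<alpha> (k p))"
      using \<alpha>_pos[OF kn[of p]] by (simp add: X_def pos_le_divide_eq)
  qed
  have conj: "ereal (\<alpha> (k p)) *
      max (convex_conjugate (centered f xs) p) (convex_conjugate (centered f xs) (- p)) \<le> ereal (k p)" for p
  proof -
    have "N (- p) = N p" using N unfolding is_norm_def by (metis abs_1 abs_minus_cancel mult_1 scaleR_minus1_left)
    then have "k (- p) = k p" by (simp add: k_def)
    then have "max (convex_conjugate (centered f xs) p) (convex_conjugate (centered f xs) (- p))
        \<le> ereal (k p / \<alpha> (k p))"
      using conj_le[of p] conj_le[of "- p"] by simp
    then have "ereal (\<alpha> (k p)) *
        max (convex_conjugate (centered f xs) p) (convex_conjugate (centered f xs) (- p))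
        \<le> ereal (\<alpha> (k p)) * ereal (k p / \<alpha> (k p))"
      using \<alpha>_pos[OF kn[of p]] by (intro ereal_mult_left_mono) auto
    also have "\<dots> = ereal (k p)" using \<alpha>_pos[OF kn[of p]] by simp
    finally show ?thesis .
  qed
  have k_diff: "k differentiable at p" for p
    unfolding k_def by (rule phi_2_1_norm_differentiable[OF N diff])
  have "k 0 = 0" by (simp add: k_def phi_2_1 is_norm_zero[OF N])
  moreover have "\<exists>\<alpha>'. \<forall>y\<ge>0. (\<alpha> has_real_derivative \<alpha>' y) (at y within {0..}) \<and> - \<gamma> * \<alpha>' y * y < \<alpha> y"
    by (rule exI[of _ "\<lambda>y. m * (1 - A) * (y + 1) powr (1 - A - 1)"])
      (use deriv slope in \<open>auto intro: has_field_derivative_at_within\<close>)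
  ultimately have "condition_A_base f k xs \<gamma> \<alpha> \<gamma>"
    unfolding condition_A_base_def
    using f k_diff kn gamma \<alpha>_pos \<alpha>_le anti convex conj by blast
  then show ?thesis by (simp add: k_def \<alpha>_def m_def)
qed

text \<open>The product is bounded by \<open>phi 2 1\<close> of the gradient norm plus the kinetic
  energy. The former costs a factor \<open>L\<close>, the latter a factor 1, whence
  \<open>max 1 L\<close>.\<close>

lemma condition_BI:
  fixes f :: "real^'n \<Rightarrow> real" and N :: "real^'n \<Rightarrow> real"
  assumes N: "is_norm N" and diff: "\<And>p. p \<noteq> 0 \<Longrightarrow> N differentiable at p"
    and f_min: "unique_minimizer f xs"
    and f_grad: "\<And>x. phi 2 1 (N (grad f x)) \<le> L * (f x - f xs)"
  shows "condition_B f (\<lambda>p. phi 2 1 (N p)) xs (max 1 L)"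
  unfolding condition_B_def
proof (intro conjI allI)
  fix x p :: "real^'n"
  let ?k = "\<lambda>p. phi 2 1 (N p)"
  define a n where "a = N (grad f x)" and "n = N p"
  define u w where "u = sqrt (a\<^sup>2 + 1)" and "w = sqrt (n\<^sup>2 + 1)"
  have Nn: "0 \<le> N q" for q using N by (simp add: is_norm_def)
  have w: "w \<ge> 1" by (simp add: w_def)
  have F: "0 \<le> f x - f xs" using f_min by (simp add: unique_minimizer_def)
  have "\<bar>grad f x \<bullet> grad ?k p\<bar> \<le> dual_norm N (grad ?k p) * N (grad f x)"
    by (subst inner_commute) (rule abs_inner_le_dual_norm[OF N])
  also have "\<dots> \<le> n / w * a"
    unfolding a_def w_def n_def by (intro mult_right_mono dual_norm_grad_phi_2_1_norm_le N diff Nn)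
  also have "\<dots> \<le> (u - 1) + (w - 1)"
  proof -
    \<comment> \<open>\<open>(u + w - 2) * w\<close> exceeds \<open>u * w - 1\<close> by exactly
      \<open>(w - 1)^2\<close>.\<close>
    have "1 + a * n \<le> u * w" unfolding u_def w_def by (rule one_plus_mult_le_sqrt)
    then have "n * a \<le> ((u - 1) + (w - 1)) * w"
      using zero_le_power2[of "w - 1"] by (simp add: power2_eq_square algebra_simps)
    then show ?thesis using w by (simp add: divide_le_eq)
  qed
  also have "\<dots> = phi 2 1 a + ?k p"
    using Nn by (simp add: u_def w_def a_def n_def phi_2_1)
  also have "\<dots> \<le> L * (f x - f xs) + ?k p" using f_grad by (simp add: a_def)
  also have "\<dots> \<le> max 1 L * (f x - f xs) + max 1 L * ?k p"
    using F mult_right_mono[of 1 "max 1 L" "?k p"] phi_2_1_nonneg[OF Nn]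
    by (intro add_mono mult_right_mono) auto
  finally show "\<bar>grad f x \<bullet> grad ?k p\<bar> \<le> max 1 L * hamiltonian f ?k xs x p"
    by (simp add: hamiltonian_def algebra_simps)
qed simp

text \<open>If \<open>lambda_max\<close> is negative the Hessian estimate is trivial, so only nonnegative values matter.\<close>

lemma condition_CI:
  fixes f :: "real^'n \<Rightarrow> real" and N :: "real^'n \<Rightarrow> real"
  assumes N: "is_norm N" and diff: "\<And>p. p \<noteq> 0 \<Longrightarrow> N differentiable at p"
    and f: "convex_on UNIV f" "unique_minimizer f xs" "twice_cont_diff_on (- {xs}) f"
    and D: "0 \<le> D" and \<alpha>: "\<And>y. 0 \<le> y \<Longrightarrow> 0 \<le> \<alpha> y"
    and bound: "\<And>x s. x \<noteq> xs \<Longrightarrow> 0 \<le> s \<Longrightarrow> 0 \<le> lambda_max (dual_norm N) (hessian f x) \<Longrightarrow>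
      lambda_max (dual_norm N) (hessian f x) * (1 - 1 / (s + 1)\<^sup>2)
        \<le> D * \<alpha> (3 * (s + (f x - f xs))) * (s + (f x - f xs))"
  shows "condition_C f (\<lambda>p. phi 2 1 (N p)) xs \<alpha> 2 D"
  unfolding condition_C_def
proof (intro conjI allI impI f inner_grad_phi_2_1_norm_self_le N diff)
  fix p x :: "real^'n" assume x: "x \<noteq> xs"
  let ?k = "\<lambda>p. phi 2 1 (N p)"
  let ?l = "lambda_max (dual_norm N) (hessian f x)"
  define H where "H = ?k p + (f x - f xs)"
  have s: "0 \<le> ?k p" using N by (simp add: phi_2_1_nonneg is_norm_def)
  have H: "0 \<le> H" using s f(2) by (simp add: H_def unique_minimizer_def)
  have "grad ?k p \<bullet> (hessian f x *v grad ?k p) \<le> ?l * (dual_norm N (grad ?k p))\<^sup>2"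
    by (rule inner_matrix_le_lambda_max[OF N])
  also have "\<dots> \<le> D * \<alpha> (3 * H) * H"
  proof (cases "0 \<le> ?l")
    case True
    have "?l * (dual_norm N (grad ?k p))\<^sup>2 \<le> ?l * (1 - 1 / (?k p + 1)\<^sup>2)"
      using True by (intro mult_left_mono dual_norm_grad_sq_le N diff)
    also have "\<dots> \<le> D * \<alpha> (3 * H) * H" unfolding H_def by (rule bound[OF x s True])
    finally show ?thesis .
  next
    case False
    then have "?l * (dual_norm N (grad ?k p))\<^sup>2 \<le> 0" by (intro mult_nonpos_nonneg) auto
    also have "0 \<le> D * \<alpha> (3 * H) * H" using D \<alpha> H by simp
    finally show ?thesis .
  qed
  finally show "grad ?k p \<bullet> (hessian f x *v grad ?k p)
      \<le> D * \<alpha> (3 * hamiltonian f ?k xs x p) * hamiltonian f ?k xs x p"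
    by (simp add: H_def hamiltonian_def algebra_simps)
qed

section \<open>Scalar Hessian estimates for \<open>B > 2\<close> and \<open>B = 2\<close>\<close>

lemma psi_phi_hessian_bound:
  assumes B: "2 < B" and nonneg: "0 \<le> s" "0 \<le> F" "0 \<le> l"
    and psi: "psi ((B - 1) / (B - 2) * phi 1 ((B - 1) / (B - 2)) l) \<le> 3 * F"
  shows "l * (1 - 1 / (s + 1)\<^sup>2) \<le> 3 * (s + F) * (3 * (s + F) + 1) powr (- (1 / (B - 1)))"
proof -
  define r where "r = (B - 1) / (B - 2)"
  define b where "b = 1 / (B - 1)"
  define c where "c = 1 - 1 / (s + 1)\<^sup>2"
  define T where "T = (l + 1) powr r - 1"
  \<comment> \<open>\<open>1 - b = 1 / r\<close> is what allows \<open>l\<close> to be recovered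
    from \<open>T\<close>.\<close>
  have r: "r > 0" "1 - b = 1 / r" using B by (simp_all add: r_def b_def field_simps)
  have b: "0 \<le> b" "b \<le> 1" using B by (auto simp: b_def)
  have c: "0 \<le> c" "c \<le> 1" using nonneg by (auto simp: c_def)
  have T: "0 \<le> T" using r nonneg by (simp add: T_def ge_one_powr_ge_zero)
  \<comment> \<open>The prefactor in the argument of \<open>psi\<close> cancels the
    \<open>1 / r\<close> inside \<open>phi\<close>, leaving \<open>T\<close>.\<close>
  have "r * phi 1 r l = T" using r nonneg by (simp add: phi_def T_def algebra_simps)
  then have "psi T \<le> 3 * F" using psi by (simp add: r_def)
  then have cT: "c * T \<le> 3 * (s + F)" unfolding c_def by (intro psi_bound nonneg T)
  have "(T + 1) powr (- b) \<le> (T + 1) powr 0" using T b by (intro powr_mono) auto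
  moreover have "l + 1 = (T + 1) powr (1 - b)" using r nonneg by (simp add: T_def powr_powr)
  moreover have "(T + 1) powr (1 - b) = (T + 1) * (T + 1) powr (- b)"
    using T by (simp add: powr_diff powr_minus field_simps)
  \<comment> \<open>\<open>l\<close> equals \<open>T * (T + 1) powr (- b)\<close> plus
    \<open>(T + 1) powr (- b) - 1\<close>, and the latter is at most 0.\<close>
  ultimately have "l \<le> T * (T + 1) powr (- b)" using T by (simp add: distrib_right)
  then have "c * l \<le> c * (T * (T + 1) powr (- b))" using c by (intro mult_left_mono)
  also have "\<dots> \<le> (c * T) * (c * T + 1) powr (- b)" by (rule mult_powr_minus_scale[OF b(1) c T])
  also have "\<dots> \<le> 3 * (s + F) * (3 * (s + F) + 1) powr (- b)"
    using b c T cT by (intro mult_powr_minus_mono) auto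
  finally show ?thesis by (simp add: c_def b_def mult.commute)
qed

text \<open>For \<open>B = 2\<close> the power in \<alpha> is a reciprocal and this replaces the
  \<open>psi\<close> argument. The case \<open>F = 0\<close> is a polynomial inequality; the rest is
  monotonicity of \<open>6 z / (3 z + 1)\<close>.\<close>

lemma one_minus_inverse_square_le:
  fixes s F :: real
  assumes "0 \<le> s" "0 \<le> F"
  shows "1 - 1 / (s + 1)\<^sup>2 \<le> 6 * (s + F) / (3 * (s + F) + 1)"
proof -
  have "1 - 1 / (s + 1)\<^sup>2 = ((s + 1)\<^sup>2 - 1) / (s + 1)\<^sup>2" using assms by (simp add: diff_divide_distrib)
  also have "\<dots> \<le> 6 * s / (3 * s + 1)"
  proof (rule iffD2[OF frac_le_eq])
    have "((s + 1)\<^sup>2 - 1) * (3 * s + 1) - 6 * s * (s + 1)\<^sup>2 = - (s * (3 * s\<^sup>2 + 5 * s + 4))"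
      by (simp add: power2_eq_square algebra_simps)
    also have "\<dots> \<le> 0" using assms by simp
    finally show "(((s + 1)\<^sup>2 - 1) * (3 * s + 1) - 6 * s * (s + 1)\<^sup>2) / ((s + 1)\<^sup>2 * (3 * s + 1)) \<le> 0"
      using assms by (intro divide_nonpos_nonneg) auto
  qed (use assms in auto)
  also have "\<dots> \<le> 6 * (s + F) / (3 * (s + F) + 1)"
  proof (rule iffD2[OF frac_le_eq])
    have "6 * s * (3 * (s + F) + 1) - 6 * (s + F) * (3 * s + 1) = - (6 * F)"
      by (simp add: algebra_simps)
    also have "\<dots> \<le> 0" using assms by simp
    finally show "(6 * s * (3 * (s + F) + 1) - 6 * (s + F) * (3 * s + 1))
        / ((3 * s + 1) * (3 * (s + F) + 1)) \<le> 0"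
      using assms by (intro divide_nonpos_nonneg) auto
  qed (use assms in auto)
  finally show ?thesis .
qed

section \<open>Assembly of the three claims\<close>

theorem proposition4p5:
  fixes N :: "real^'n \<Rightarrow> real"
    and f k :: "real^'n \<Rightarrow> real"
    and xs :: "real^'n"
    and \<gamma> A B \<mu> L :: real
    and \<alpha> :: "real \<Rightarrow> real"
  assumes N_norm: "is_norm N"
    and N_diff: "\<And>p. p \<noteq> 0 \<Longrightarrow> N differentiable at p"
    and gamma: "0 < \<gamma>" "\<gamma> < 1"
    and k_def: "k = (\<lambda>p. phi 2 1 (N p))"
    and B: "B \<ge> 2"
    and A_def: "A = B / (B - 1)"
    and f_diff: "\<And>x. f differentiable at x"
    and f_convex: "convex_on UNIV f"
    and f_min: "unique_minimizer f xs"
    and mu: "\<mu> > 0"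
    and L: "L > 0"
    and f_lower: "\<And>x. f x - f xs \<ge> \<mu> * phi 2 B (dual_norm N (x - xs))"
    and f_grad: "\<And>x. phi 2 1 (N (grad f x)) \<le> L * (f x - f xs)"
    and alpha_def: "\<alpha> = (\<lambda>y. min (min (\<mu> powr (A - 1)) \<mu>) 1 * (y + 1) powr (1 - A))"
  shows
    "(condition_A_base f k xs \<gamma> \<alpha> \<gamma> \<and> convex_on UNIV k \<and>
      (rotund N \<longrightarrow> condition_A f k xs \<gamma> \<alpha> \<gamma>) \<and>
      condition_B f k xs (max 1 L) \<and>
      (\<exists>y\<ge>0. \<exists>z\<ge>0. \<alpha> y \<noteq> \<alpha> z))
     \<and>
     (\<forall>L\<^sub>f. B > 2 \<longrightarrow> twice_cont_diff_on (- {xs}) f \<longrightarrow> L\<^sub>f > 0 \<longrightarrow>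
       (\<forall>x. x \<noteq> xs \<longrightarrow>
         psi ((B - 1) / (B - 2) *
           phi 1 ((B - 1) / (B - 2)) (lambda_max (dual_norm N) (hessian f x) / L\<^sub>f))
         \<le> 3 * (f x - f xs)) \<longrightarrow>
       condition_A_base f k xs \<gamma> \<alpha> \<gamma> \<and> convex_on UNIV k \<and>
       (rotund N \<longrightarrow> condition_A f k xs \<gamma> \<alpha> \<gamma>) \<and>
       condition_B f k xs (max 1 L) \<and>
       condition_C f k xs \<alpha> 2 (3 * L\<^sub>f / min (min (\<mu> powr (A - 1)) \<mu>) 1))
     \<and>
     (\<forall>L\<^sub>f. B = 2 \<longrightarrow> twice_cont_diff_on (- {xs}) f \<longrightarrow> L\<^sub>f > 0 \<longrightarrow>
       (\<forall>x. x \<noteq> xs \<longrightarrow> lambda_max (dual_norm N) (hessian f x) \<le> L\<^sub>f) \<longrightarrow>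
       condition_A_base f k xs \<gamma> \<alpha> \<gamma> \<and> convex_on UNIV k \<and>
       (rotund N \<longrightarrow> condition_A f k xs \<gamma> \<alpha> \<gamma>) \<and>
       condition_B f k xs (max 1 L) \<and>
       condition_C f k xs \<alpha> 2 (6 * L\<^sub>f / min \<mu> 1))"
proof -
  have A: "1 < A" "A \<le> 2" "1 / A + 1 / B = 1" "1 - A = - (1 / (B - 1))"
    using B by (simp_all add: A_def field_simps)
  \<comment> \<open>\<open>A - 1\<close> lies in (0, 1], so \<open>\<mu> powr (A - 1)\<close> lies
    between \<open>\<mu>\<close> and 1 and never decides the minimum.\<close>
  have m_eq: "min (min (\<mu> powr (A - 1)) \<mu>) 1 = min \<mu> 1"
  proof (cases "\<mu> \<ge> 1")
    case True
    then show ?thesis using A by (simp add: ge_one_powr_ge_zero)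
  next
    case False
    then have "\<mu> powr 1 \<le> \<mu> powr (A - 1)" using A mu by (intro powr_mono') auto
    then show ?thesis using False mu by simp
  qed
  have m: "0 < min \<mu> 1" using mu by simp
  have \<alpha>_eq: "\<alpha> = (\<lambda>y. min \<mu> 1 * (y + 1) powr (1 - A))" by (simp add: alpha_def m_eq)
  have \<alpha>_nonneg: "0 \<le> \<alpha> y" for y using m by (simp add: \<alpha>_eq)
  have F: "0 \<le> f x - f xs" for x using f_min by (simp add: unique_minimizer_def)
  have A_base: "condition_A_base f k xs \<gamma> \<alpha> \<gamma>"
    unfolding k_def \<alpha>_eq
    by (rule condition_A_baseI[OF N_norm N_diff gamma A(1,2) _ A(3) f_diff f_convex f_min mu f_lower])
      (use B in auto)
  have k_convex: "convex_on UNIV k" unfolding k_def by (rule phi_2_1_norm_convex[OF N_norm])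
  have A_cond: "rotund N \<longrightarrow> condition_A f k xs \<gamma> \<alpha> \<gamma>"
    using A_base phi_2_1_norm_strictly_convex[OF N_norm] by (auto simp: condition_A_def k_def)
  have B_cond: "condition_B f k xs (max 1 L)"
    unfolding k_def by (rule condition_BI[OF N_norm N_diff f_min f_grad])
  \<comment> \<open>The exponent is negative, so \<alpha> already takes different values at 0 and
    1.\<close>
  have "(2::real) powr (1 - A) \<noteq> 2 powr 0" using A by (subst powr_inj) auto
  then have "\<alpha> 0 \<noteq> \<alpha> 1" using m by (simp add: \<alpha>_eq)
  then have nonconst: "\<exists>y\<ge>0. \<exists>z\<ge>0. \<alpha> y \<noteq> \<alpha> z" by (meson zero_le_one order_refl)
  have C_gt: "condition_C f k xs \<alpha> 2 (3 * L\<^sub>f / min (min (\<mu> powr (A - 1)) \<mu>) 1)"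
    if "B > 2" and twice: "twice_cont_diff_on (- {xs}) f" and Lf: "L\<^sub>f > 0"
      and psi: "\<forall>x. x \<noteq> xs \<longrightarrow> psi ((B - 1) / (B - 2) *
        phi 1 ((B - 1) / (B - 2)) (lambda_max (dual_norm N) (hessian f x) / L\<^sub>f)) \<le> 3 * (f x - f xs)"
    for L\<^sub>f
    unfolding k_def m_eq
  proof (rule condition_CI[OF N_norm N_diff f_convex f_min twice])
    fix x s assume x: "x \<noteq> xs" and s: "0 \<le> (s::real)"
      and l: "0 \<le> lambda_max (dual_norm N) (hessian f x)"
    let ?l = "lambda_max (dual_norm N) (hessian f x)"
    let ?H = "s + (f x - f xs)"
    \<comment> \<open>The estimate is for the normalised value \<open>?l / L\<^sub>f\<close>;
      multiplying by \<open>L\<^sub>f\<close> undoes the normalisation.\<close>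
    have "?l / L\<^sub>f * (1 - 1 / (s + 1)\<^sup>2) \<le> 3 * ?H * (3 * ?H + 1) powr (1 - A)"
      unfolding A(4) using psi x l Lf by (intro psi_phi_hessian_bound \<open>B > 2\<close> s F) auto
    then have "L\<^sub>f * (?l / L\<^sub>f * (1 - 1 / (s + 1)\<^sup>2)) \<le> L\<^sub>f * (3 * ?H * (3 * ?H + 1) powr (1 - A))"
      using Lf by (intro mult_left_mono) auto
    moreover have "L\<^sub>f * (?l / L\<^sub>f * (1 - 1 / (s + 1)\<^sup>2)) = ?l * (1 - 1 / (s + 1)\<^sup>2)"
      using Lf by simp
    \<comment> \<open>The denominator of the constant cancels the prefactor of \<alpha>, and its 3
      joins \<open>?H\<close> to form \<open>G\<close> at \<open>3 * ?H\<close>.\<close>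
    moreover have "3 * L\<^sub>f / min \<mu> 1 * \<alpha> (3 * ?H) * ?H = L\<^sub>f * (3 * ?H * (3 * ?H + 1) powr (1 - A))"
      using m unfolding \<alpha>_eq by (simp del: distrib_left_numeral)
    ultimately show "?l * (1 - 1 / (s + 1)\<^sup>2) \<le> 3 * L\<^sub>f / min \<mu> 1 * \<alpha> (3 * ?H) * ?H"
      by simp
  qed (use Lf m \<alpha>_nonneg in auto)
  have C_eq: "condition_C f k xs \<alpha> 2 (6 * L\<^sub>f / min \<mu> 1)"
    if "B = 2" and twice: "twice_cont_diff_on (- {xs}) f" and Lf: "L\<^sub>f > 0"
      and le: "\<forall>x. x \<noteq> xs \<longrightarrow> lambda_max (dual_norm N) (hessian f x) \<le> L\<^sub>f" for L\<^sub>f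
    unfolding k_def
  proof (rule condition_CI[OF N_norm N_diff f_convex f_min twice])
    fix x s assume x: "x \<noteq> xs" and s: "0 \<le> (s::real)"
      and l: "0 \<le> lambda_max (dual_norm N) (hessian f x)"
    let ?H = "s + (f x - f xs)"
    have H: "0 \<le> ?H" using s F[of x] by simp
    have "lambda_max (dual_norm N) (hessian f x) * (1 - 1 / (s + 1)\<^sup>2) \<le> L\<^sub>f * (6 * ?H / (3 * ?H + 1))"
      using le x Lf s by (intro mult_mono one_minus_inverse_square_le F) auto
    \<comment> \<open>\<open>B = 2\<close> gives \<open>A = 2\<close>, hence the exponent
      -1.\<close>
    moreover have "\<alpha> (3 * ?H) = min \<mu> 1 / (3 * ?H + 1)"
      using H \<open>B = 2\<close> unfolding \<alpha>_eq A_def by (simp add: powr_minus_divide del: distrib_left_numeral)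
    then have "6 * L\<^sub>f / min \<mu> 1 * \<alpha> (3 * ?H) * ?H = L\<^sub>f * (6 * ?H / (3 * ?H + 1))"
      using m by (simp del: distrib_left_numeral)
    ultimately show "lambda_max (dual_norm N) (hessian f x) * (1 - 1 / (s + 1)\<^sup>2)
        \<le> 6 * L\<^sub>f / min \<mu> 1 * \<alpha> (3 * ?H) * ?H"
      by simp
  qed (use Lf m \<alpha>_nonneg in auto)
  show ?thesis
    using A_base k_convex A_cond B_cond nonconst C_gt C_eq by blast
qed

end
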